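(* Let $f:[0,\infty)\to\mathbb{R}$ be a superquadratic function and let $\varphi:[0,\infty)\to\mathbb{R}$ be a function such that $f(y)\ge f(x)+\varphi(x)(y-x)+f(|y-x|)$ for all $x,y\ge0$. Let $x_1,\dots,x_n\ge 0$, let $(a_1,\dots,a_n)$ be a nonnegative $n$-tuple with $A_n=\sum_{i=1}^n a_i>0$, and let $\overline{x}=\frac{1}{A_n}\sum_{i=1}^n a_ix_i$. Then $$\frac{1}{A_n}\sum_{i=1}^n a_if(x_i)-f(\overline{x})\le\frac{1}{A_n}\sum_{i=1}^n a_i\varphi(x_i)(x_i-\overline{x})-\frac{1}{A_n}\sum_{i=1}^n a_if(|\overline{x}-x_i|).$$
   Context: A function $f:[0,\infty)\to\mathbb{R}$ is superquadratic if for every $x\ge0$ there is a constant $C_x\in\mathbb{R}$ such that $f(y)\ge f(x)+C_x(y-x)+f(|y-x|)$ for all $y\ge0$; thus $\varphi(x)=C_x$ is a choice of such constants. *)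

theory Defs
  imports Complex_Main
begin

(* A function on [0, \<infinity>) is represented by a total function on the reals;
   only its values at nonnegative arguments are used. *)
definition superquadratic :: "(real \<Rightarrow> real) \<Rightarrow> bool" where
  "superquadratic f \<longleftrightarrow>
     (\<forall>x\<ge>0. \<exists>C. \<forall>y\<ge>0. f y \<ge> f x + C * (y - x) + f \<bar>y - x\<bar>)"

end

theory Submission
  imports Defs
begin

text \<open>The defining inequality is used with base point \<open>x i\<close> and evaluation point
  \<open>xbar\<close>, the reverse of the choice that yields the Jensen-type lower bound. It then
  bounds each \<open>f (x i)\<close> from above by \<open>f xbar\<close> plus a slope term minus
  \<open>f \<bar>xbar - x i\<bar>\<close>. Averaging with the weights \<open>a i\<close> gives the
  claim; the slopes \<open>\<phi> (x i)\<close> vary with \<open>i\<close>, so their term stays on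
  the right.\<close>

theorem theorem17:
  fixes f \<phi> :: "real \<Rightarrow> real" and n :: nat and x a :: "nat \<Rightarrow> real" and A xbar :: real
  assumes "superquadratic f"
    and "\<And>x y. x \<ge> 0 \<Longrightarrow> y \<ge> 0 \<Longrightarrow> f y \<ge> f x + \<phi> x * (y - x) + f \<bar>y - x\<bar>"
    and "\<And>i. i \<in> {1..n} \<Longrightarrow> x i \<ge> 0"
    and "\<And>i. i \<in> {1..n} \<Longrightarrow> a i \<ge> 0"
    and "A = (\<Sum>i=1..n. a i)"
    and "A > 0"
    and "xbar = 1 / A * (\<Sum>i=1..n. a i * x i)"
  shows "1 / A * (\<Sum>i=1..n. a i * f (x i)) - f xbar
      \<le> 1 / A * (\<Sum>i=1..n. a i * \<phi> (x i) * (x i - xbar))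
        - 1 / A * (\<Sum>i=1..n. a i * f \<bar>xbar - x i\<bar>)"
proof -
  \<comment> \<open>This makes \<open>xbar\<close> an admissible evaluation point, since the
    inequality for \<open>f\<close> is assumed only on nonnegative arguments.\<close>
  have "xbar \<ge> 0"
    unfolding assms(7) using assms(3,4,6) by (intro mult_nonneg_nonneg sum_nonneg) auto
  have "(\<Sum>i=1..n. a i * f (x i))
      \<le> (\<Sum>i=1..n. a i * f xbar + a i * \<phi> (x i) * (x i - xbar) - a i * f \<bar>xbar - x i\<bar>)"
  proof (rule sum_mono)
    fix i assume i: "i \<in> {1..n}"
    \<comment> \<open>Solving for the value at the base point turns \<open>xbar - x i\<close> into
      \<open>x i - xbar\<close> in the slope term.\<close>
    have "f (x i) \<le> f xbar + \<phi> (x i) * (x i - xbar) - f \<bar>xbar - x i\<bar>"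
      using assms(2)[OF assms(3)[OF i] \<open>xbar \<ge> 0\<close>] by (simp add: algebra_simps)
    from mult_left_mono[OF this assms(4)[OF i]]
    show "a i * f (x i)
        \<le> a i * f xbar + a i * \<phi> (x i) * (x i - xbar) - a i * f \<bar>xbar - x i\<bar>"
      by (simp add: algebra_simps)
  qed
  also have "\<dots> = A * f xbar + (\<Sum>i=1..n. a i * \<phi> (x i) * (x i - xbar))
      - (\<Sum>i=1..n. a i * f \<bar>xbar - x i\<bar>)"
    \<comment> \<open>The constant \<open>f xbar\<close> factors out with total weight
      \<open>A\<close>.\<close>
    by (simp add: assms(5) sum.distrib sum_subtractf sum_distrib_right)
  finally have "(\<Sum>i=1..n. a i * f (x i)) - A * f xbar
      \<le> (\<Sum>i=1..n. a i * \<phi> (x i) * (x i - xbar)) - (\<Sum>i=1..n. a i * f \<bar>xbar - x i\<bar>)"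
    by linarith
  from divide_right_mono[OF this, of A] show ?thesis
    using \<open>A > 0\<close> by (simp add: diff_divide_distrib)
qed

end
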